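(* Let $r,n$ be positive integers with $r\equiv 2 \pmod 4$. (1) Let $\pi\in A_{r,n}$ and let $\omega=s_0^{z_1}b_1s_0^{z_2}b_2\cdots s_0^{z_n}b_n$, with each $b_i$ a (possibly empty) word in the letters $s_1,\dots,s_{n-1}$, be the canonical word of $\pi$ with respect to $\mathcal S=\{s_0,\dots,s_{n-1}\}$. Then the translation of $\omega$ to the generators in $\mathcal A$ is $$a_0^{z_1\oslash 2}\,b_1'\,a_0^{z_2\oslash 2}\,b_2'\cdots a_0^{z_n\oslash 2}\,b_n',$$ where each $b_i'$ is a word in the letters of $\mathcal A\setminus\{a_0\}$. Moreover, if $b_i=s_{i_1}\cdots s_{i_k}$, then $b_i'=a_{i_1}^{\varepsilon_{i_1}}\cdots a_{i_k}^{\varepsilon_{i_k}}$, where $\varepsilon_{i_j}\in\{\pm1\}$ if $i_j=1$ and $\varepsilon_{i_j}=1$ otherwise (the sign is attached to each letter occurrence). (2) For every $\pi\in A_{r,n}$, the number $L_A(\pi)$ of letters of the translated canonical word of $\pi$ is $$L_A(\pi)=\sum_{i:\,z_i(\pi)\neq 0}(i-1)+\mathrm{inv}(\pi)+\sum_{i=1}^n\bigl(z_i(\pi)\oslash 2\bigr).$$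
   Context: Group. $G_{r,n}=\mathbb{Z}_r\wr S_n$ is the set of pairs $(\vec z,\tau)$ with $\vec z=(z_1,\dots,z_n)\in\{0,\dots,r-1\}^n$, $\tau\in S_n$, with product $(\vec z,\tau)(\vec z',\tau')=((z_1+z'_{\tau^{-1}(1)},\dots,z_n+z'_{\tau^{-1}(n)}),\tau\circ\tau')$, addition mod $r$. For $\pi=(\vec z,\tau)$: $z_i(\pi)=z_i$ is the color of the digit $i$; $|\pi|=(\vec 0,\tau)$ is identified with $\tau$; $c_i(\pi)=z_{\tau(i)}$ is the color of the digit in place $i$; the window notation is $\pi=(\tau(1)^{[c_1]}\cdots\tau(n)^{[c_n]})$, and $\pi(i)=\tau(i)^{[c_i]}$ (color $0$ may be omitted). The generator $s_0$ is the pair with vector $(1,0,\dots,0)$ and identity permutation; for $1\le i\le n-1$, $s_i$ is the pair with zero vector and transposition $(i\ i+1)$. Alternating subgroup. For $r$ even, $A_{r,n}$ is the kernel of the homomorphism $G_{r,n}\to\{\pm1\}$ sending every $s_i$, $0\le i\le n-1$, to $-1$. Put $a_0=s_0^2$, $a_i=s_0^{r/2}s_i$ for $1\le i\le n-1$, and $\mathcal A=\{a_0,a_1,a_1^{-1},a_2,\dots,a_{n-1}\}$. Operator $\oslash$. For a nonnegative integer $a$, $a\oslash 2\in\{0,\dots,\frac r2-1\}$ is the residue modulo $\frac r2$ of $\frac a2$ if $a$ is even, and of $\frac{a+r/2}{2}$ if $a$ is odd. Inversions. The length order on colored digits is $n^{[r-1]}<\cdots<n^{[1]}<\cdots<1^{[r-1]}<\cdots<1^{[1]}<1<2<\cdots<n$;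 $\mathrm{inv}(\pi)=|\{(i,j): i<j,\ \pi(i)>\pi(j)\}|$ in this order. Canonical word over $\mathcal S$. Let $i_1<\dots<i_c$ be the digits $i$ with $z_i(\pi)\ne0$. The coloring part is the concatenation, for $k=1,\dots,c$ from left to right, of $s_{i_k-1}s_{i_k-2}\cdots s_1s_0^{z_{i_k}(\pi)}$; it represents an element $\sigma$ whose window is increasing in the length order. The ordering part is obtained by starting with $\pi$ and, for $k=1,2,\dots,n-1$ successively, multiplying on the right by $u_k=s_{p-1}s_{p-2}\cdots s_k$, where $p$ is the current place of the digit $|\sigma|(k)$ ($u_k$ is empty if $p=k$), so that $\pi u_1\cdots u_{n-1}=\sigma$; the ordering part is the word $u_{n-1}^{-1}\cdots u_1^{-1}$, where $u_k^{-1}=s_k\cdots s_{p-1}$. The canonical word of $\pi$ is the coloring part followed by the ordering part. Thus it has the form $s_0^{z_1}b_1\cdots s_0^{z_n}b_n$ with $z_i=z_i(\pi)$, where for $i<n$ the word $b_i$ is $s_is_{i-1}\cdots s_1$ if $z_{i+1}(\pi)\neq0$ and empty otherwise, and $b_n$ is the ordering part. Translation to $\mathcal A$. For $\pi\in A_{r,n}$ the canonical word has even length. Cut it into consecutive pairs of letters, replace each pair $s_is_j$ by $(s_is_0^{r/2})(s_0^{r/2}s_j)$, and rewrite each factor using $s_is_0^{r/2}=s_0^{r/2}s_i=a_i$ for $i\ge2$, $s_1s_0^{r/2}=a_1^{-1}$, $s_0^{r/2}s_1=a_1$, $s_0s_0^{r/2}=a_0^{(r+2)/4}$; finally replace each maximal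 run of letters $a_0$ by $a_0^m$ with $0\le m<\frac r2$ using $a_0^{r/2}=1$. $L_A(\pi)$ is the number of letters from $\mathcal A$ in the resulting word. *)

theory Defs
  imports "HOL-Algebra.Sym_Groups"
begin

section \<open>The group of colored permutations\<close>

text \<open>
  A colored permutation of \<open>{1..n}\<close> is a pair \<open>(z, \<tau>)\<close>. The color vector \<open>z\<close> is a function that
  vanishes outside \<open>{1..n}\<close>, so that distinct pairs represent distinct group elements.
\<close>

type_synonym colored_perm = "(nat \<Rightarrow> nat) \<times> (nat \<Rightarrow> nat)"

definition colored_perm_group :: "nat \<Rightarrow> nat \<Rightarrow> colored_perm monoid" where
  "colored_perm_group r n =
     \<lparr> carrier = {z. (\<forall>i\<in>{1..n}. z i < r) \<and> (\<forall>i. i \<notin> {1..n} \<longrightarrow> z i = 0)} \<times> {\<tau>. \<tau> permutes {1..n}},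
       mult = (\<lambda>(z, \<tau>) (z', \<tau>'). (\<lambda>i. (z i + z' (inv' \<tau> i)) mod r, \<tau> \<circ> \<tau>')),
       one = (\<lambda>_. 0, id) \<rparr>"

definition digit_color :: "colored_perm \<Rightarrow> nat \<Rightarrow> nat" where
  "digit_color \<pi> i = fst \<pi> i"

definition window :: "colored_perm \<Rightarrow> nat \<Rightarrow> nat \<times> nat" where
  "window \<pi> i = (snd \<pi> i, digit_color \<pi> (snd \<pi> i))"

definition s_gen :: "nat \<Rightarrow> colored_perm" where
  "s_gen i = (if i = 0 then (\<lambda>j. if j = 1 then 1 else 0, id) else (\<lambda>_. 0, transpose i (i + 1)))"

text \<open>
  Words are lists of letters; the letter \<open>i\<close> of a word over the generators of the whole group
  stands for \<open>s_gen i\<close>.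
\<close>

definition word_value :: "('g, 'm) monoid_scheme \<Rightarrow> ('l \<Rightarrow> 'g) \<Rightarrow> 'l list \<Rightarrow> 'g" where
  "word_value G f w = foldr (\<lambda>x g. f x \<otimes>\<^bsub>G\<^esub> g) w \<one>\<^bsub>G\<^esub>"


section \<open>The alternating subgroup\<close>

text \<open>
  Since the \<open>s_gen i\<close> generate the group, at most one homomorphism to \<open>{1, -1}\<close> (up to its values
  outside the carrier) sends all of them to \<open>-1\<close>; for even \<open>r\<close> there is one, see
  \<open>alt_character_exists\<close> below.
\<close>

definition alt_character :: "nat \<Rightarrow> nat \<Rightarrow> colored_perm \<Rightarrow> int" where
  "alt_character r n =
     (SOME \<chi>. \<chi> \<in> hom (colored_perm_group r n) sign_img \<and> (\<forall>i<n. \<chi> (s_gen i) = -1))"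

definition alternating_subgroup :: "nat \<Rightarrow> nat \<Rightarrow> colored_perm set" where
  "alternating_subgroup r n = kernel (colored_perm_group r n) sign_img (alt_character r n)"

definition a_gen :: "nat \<Rightarrow> nat \<Rightarrow> nat \<Rightarrow> colored_perm" where
  "a_gen r n i =
     (if i = 0 then s_gen 0 [^]\<^bsub>colored_perm_group r n\<^esub> (2::nat)
      else (s_gen 0 [^]\<^bsub>colored_perm_group r n\<^esub> (r div 2)) \<otimes>\<^bsub>colored_perm_group r n\<^esub> s_gen i)"

text \<open>
  A letter over the generators of the alternating subgroup is a pair \<open>(i, \<epsilon>)\<close>, standing for
  \<open>a_gen r n i\<close> raised to the power \<open>\<epsilon>\<close>; only \<open>i = 1\<close> admits \<open>\<epsilon> = -1\<close>.
\<close>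

type_synonym a_letter = "nat \<times> int"

definition a_letters :: "nat \<Rightarrow> a_letter set" where
  "a_letters n = {(i, \<epsilon>). i < n \<and> (\<epsilon> = 1 \<or> i = 1 \<and> \<epsilon> = -1)}"

abbreviation a0 :: a_letter where
  "a0 \<equiv> (0, 1)"

definition a_letter_value :: "nat \<Rightarrow> nat \<Rightarrow> a_letter \<Rightarrow> colored_perm" where
  "a_letter_value r n = (\<lambda>(i, \<epsilon>). a_gen r n i [^]\<^bsub>colored_perm_group r n\<^esub> \<epsilon>)"


section \<open>Halving modulo \<open>r/2\<close>\<close>

definition oslash2 :: "nat \<Rightarrow> nat \<Rightarrow> nat" where
  "oslash2 r a = (if even a then a div 2 else (a + r div 2) div 2) mod (r div 2)"


section \<open>Length order and inversions\<close>

text \<open>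
  The order \<open>n^[r-1] < \<dots> < n^[1] < \<dots> < 1^[r-1] < \<dots> < 1^[1] < 1 < 2 < \<dots> < n\<close> on pairs
  (digit, color).
\<close>

definition length_less :: "nat \<times> nat \<Rightarrow> nat \<times> nat \<Rightarrow> bool" where
  "length_less = (\<lambda>(i, c) (j, d).
     if c = 0 then d = 0 \<and> i < j
     else d = 0 \<or> j < i \<or> i = j \<and> d < c)"

definition inversions :: "nat \<Rightarrow> colored_perm \<Rightarrow> nat" where
  "inversions n \<pi> =
     card {(i, j). i \<in> {1..n} \<and> j \<in> {1..n} \<and> i < j \<and> length_less (window \<pi> j) (window \<pi> i)}"


section \<open>The canonical word\<close>

text \<open>Note that \<open>rev [1..<i]\<close> is the word \<open>i-1, i-2, \<dots>, 1\<close>.\<close>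

definition coloring_part :: "nat \<Rightarrow> colored_perm \<Rightarrow> nat list" where
  "coloring_part n \<pi> =
     concat (map (\<lambda>i. rev [1..<i] @ replicate (digit_color \<pi> i) 0)
       (filter (\<lambda>i. digit_color \<pi> i \<noteq> 0) [1..<n+1]))"

definition colored_part :: "nat \<Rightarrow> nat \<Rightarrow> colored_perm \<Rightarrow> colored_perm" where
  "colored_part r n \<pi> = word_value (colored_perm_group r n) s_gen (coloring_part n \<pi>)"

text \<open>
  \<open>sort_word \<sigma> \<rho> k\<close> is the word \<open>s\<^bsub>p-1\<^esub> s\<^bsub>p-2\<^esub> \<dots> s\<^bsub>k\<^esub>\<close>, where \<open>p\<close> is the place of the digit \<open>|\<sigma>|(k)\<close>
  in \<open>\<rho>\<close>; \<open>sort_state r n \<pi> k\<close> is \<open>\<pi> u\<^sub>1 \<dots> u\<^sub>k\<close>.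
\<close>

definition sort_word :: "colored_perm \<Rightarrow> colored_perm \<Rightarrow> nat \<Rightarrow> nat list" where
  "sort_word \<sigma> \<rho> k = rev [k..<inv' (snd \<rho>) (snd \<sigma> k)]"

fun sort_state :: "nat \<Rightarrow> nat \<Rightarrow> colored_perm \<Rightarrow> nat \<Rightarrow> colored_perm" where
  "sort_state r n \<pi> 0 = \<pi>"
| "sort_state r n \<pi> (Suc k) =
     sort_state r n \<pi> k \<otimes>\<^bsub>colored_perm_group r n\<^esub>
       word_value (colored_perm_group r n) s_gen
         (sort_word (colored_part r n \<pi>) (sort_state r n \<pi> k) (Suc k))"

definition sort_factor :: "nat \<Rightarrow> nat \<Rightarrow> colored_perm \<Rightarrow> nat \<Rightarrow> nat list" where
  "sort_factor r n \<pi> k = sort_word (colored_part r n \<pi>) (sort_state r n \<pi> (k - 1)) k"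

definition ordering_part :: "nat \<Rightarrow> nat \<Rightarrow> colored_perm \<Rightarrow> nat list" where
  "ordering_part r n \<pi> = concat (map (\<lambda>k. rev (sort_factor r n \<pi> k)) (rev [1..<n]))"

definition canonical_word :: "nat \<Rightarrow> nat \<Rightarrow> colored_perm \<Rightarrow> nat list" where
  "canonical_word r n \<pi> = coloring_part n \<pi> @ ordering_part r n \<pi>"

text \<open>
  The words \<open>b\<^sub>i\<close> in the form \<open>s\<^sub>0^z\<^sub>1 b\<^sub>1 \<dots> s\<^sub>0^z\<^sub>n b\<^sub>n\<close> of the canonical word, see
  \<open>canonical_word_blocks\<close> below.
\<close>

definition canonical_block :: "nat \<Rightarrow> nat \<Rightarrow> colored_perm \<Rightarrow> nat \<Rightarrow> nat list" where
  "canonical_block r n \<pi> i =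
     (if i = n then ordering_part r n \<pi>
      else if digit_color \<pi> (i + 1) \<noteq> 0 then rev [1..<i+1] else [])"


section \<open>Translation to the generators of the alternating subgroup\<close>

text \<open>\<open>left_factor r i\<close> and \<open>right_factor r i\<close> rewrite \<open>s\<^sub>i s\<^sub>0^(r/2)\<close> and \<open>s\<^sub>0^(r/2) s\<^sub>i\<close>.\<close>

definition left_factor :: "nat \<Rightarrow> nat \<Rightarrow> a_letter list" where
  "left_factor r i =
     (if i = 0 then replicate ((r + 2) div 4) a0 else if i = 1 then [(1, -1)] else [(i, 1)])"

definition right_factor :: "nat \<Rightarrow> nat \<Rightarrow> a_letter list" where
  "right_factor r i = (if i = 0 then replicate ((r + 2) div 4) a0 else [(i, 1)])"

text \<open>Only words of even length are translated.\<close>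

fun translate_pairs :: "nat \<Rightarrow> nat list \<Rightarrow> a_letter list" where
  "translate_pairs r [] = []"
| "translate_pairs r [i] = undefined"
| "translate_pairs r (i # j # w) = left_factor r i @ right_factor r j @ translate_pairs r w"

function reduce_runs :: "nat \<Rightarrow> a_letter list \<Rightarrow> a_letter list" where
  "reduce_runs r [] = []"
| "reduce_runs r (x # w) =
     (if x = a0
      then replicate (length (takeWhile (\<lambda>y. y = a0) (x # w)) mod (r div 2)) a0 @
             reduce_runs r (dropWhile (\<lambda>y. y = a0) w)
      else x # reduce_runs r w)"
  by pat_completeness auto
termination
  by (relation "measure (\<lambda>(r, w). length w)") (auto simp: le_imp_less_Suc length_dropWhile_le)

definition translation :: "nat \<Rightarrow> nat list \<Rightarrow> a_letter list" where
  "translation r w = reduce_runs r (translate_pairs r w)"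

definition L_A :: "nat \<Rightarrow> nat \<Rightarrow> colored_perm \<Rightarrow> nat" where
  "L_A r n \<pi> = length (translation r (canonical_word r n \<pi>))"


section \<open>Consistency of the definitions\<close>

lemma colored_perm_group_simps:
  "(z, \<tau>) \<in> carrier (colored_perm_group r n) \<longleftrightarrow>
     (\<forall>i\<in>{1..n}. z i < r) \<and> (\<forall>i. i \<notin> {1..n} \<longrightarrow> z i = 0) \<and> \<tau> permutes {1..n}"
  "(z, \<tau>) \<otimes>\<^bsub>colored_perm_group r n\<^esub> (z', \<tau>') = (\<lambda>i. (z i + z' (inv' \<tau> i)) mod r, \<tau> \<circ> \<tau>')"
  "\<one>\<^bsub>colored_perm_group r n\<^esub> = (\<lambda>_. 0, id)"
  by (simp_all add: colored_perm_group_def)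

lemma carrier_color_less:
  assumes "(z, \<tau>) \<in> carrier (colored_perm_group r n)" "r > 0"
  shows "z i < r"
  using assms by (cases "i \<in> {1..n}") (auto simp: colored_perm_group_simps)

lemma colored_perm_group_is_group:
  assumes "r > 0"
  shows "group (colored_perm_group r n)"
proof (rule groupI, goal_cases)
  case (1 x y)
  obtain z t z' t' where "x = (z, t)" "y = (z', t')" by (metis surj_pair)
  with 1 assms show ?case
    by (auto simp: colored_perm_group_simps permutes_compose permutes_not_in[OF permutes_inv])
next
  case 2
  show ?case using assms by (auto simp: colored_perm_group_simps permutes_id)
next
  case (3 x y w)
  obtain z t z' t' z'' t'' where xyw: "x = (z, t)" "y = (z', t')" "w = (z'', t'')"
    by (metis surj_pair)
  have "bij t" "bij t'"
    using 3 xyw by (auto simp: colored_perm_group_simps intro: permutes_bij)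
  then show ?case
    by (simp add: xyw colored_perm_group_simps o_inv_distrib comp_assoc mod_simps add.assoc)
next
  case (4 x)
  obtain z t where x: "x = (z, t)" by (metis surj_pair)
  show ?case
    using carrier_color_less[OF 4[unfolded x] assms] by (simp add: x colored_perm_group_simps)
next
  case (5 x)
  obtain z t where x: "x = (z, t)" by (metis surj_pair)
  have t: "t permutes {1..n}" using 5 x by (simp add: colored_perm_group_simps)
  have less: "z i < r" for i using carrier_color_less[OF 5[unfolded x] assms] .
  define y where "y = (\<lambda>i. (r - z (t i)) mod r, inv' t)"
  have "t i \<notin> {1..n}" if "i \<notin> {1..n}" for i
    using t that by (metis permutes_in_image)
  then have "y \<in> carrier (colored_perm_group r n)"
    using 5 assms by (auto simp: x y_def colored_perm_group_simps permutes_inv)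
  moreover have "((r - z (t i)) mod r + z (t i)) mod r = 0" for i
    using less[of "t i"] by (simp add: mod_simps)
  then have "y \<otimes>\<^bsub>colored_perm_group r n\<^esub> x = \<one>\<^bsub>colored_perm_group r n\<^esub>"
    using t by (simp add: x y_def colored_perm_group_simps permutes_inv_o permutes_inv_inv)
  ultimately show ?case by blast
qed

lemma s_gen_carrier:
  assumes "r > 1" "i < n"
  shows "s_gen i \<in> carrier (colored_perm_group r n)"
  using assms by (auto simp: s_gen_def colored_perm_group_simps permutes_id permutes_swap_id)

lemma alt_character_exists:
  assumes "even r" "r > 0"
  shows "\<exists>\<chi>. \<chi> \<in> hom (colored_perm_group r n) sign_img \<and> (\<forall>i<n. \<chi> (s_gen i) = -1)"
proof -
  define \<chi> :: "colored_perm \<Rightarrow> int" where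
    "\<chi> = (\<lambda>(z, t). sign t * (-1) ^ (\<Sum>i=1..n. z i))"
  have "\<chi> (x \<otimes>\<^bsub>colored_perm_group r n\<^esub> y) = \<chi> x * \<chi> y"
    if "x \<in> carrier (colored_perm_group r n)" "y \<in> carrier (colored_perm_group r n)" for x y
  proof -
    obtain z t z' t' where xy: "x = (z, t)" "y = (z', t')" by (metis surj_pair)
    have t: "t permutes {1..n}" "t' permutes {1..n}"
      using that xy by (auto simp: colored_perm_group_simps)
    have "(-1::int) ^ (a mod r) = (-1) ^ a" for a
      using assms by (simp add: minus_one_power_iff dvd_mod_iff)
    then have "(-1::int) ^ (\<Sum>i=1..n. (z i + z' (inv' t i)) mod r)
        = (-1) ^ (\<Sum>i=1..n. z i + z' (inv' t i))"
      by (simp add: power_sum)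
    also have "(\<Sum>i=1..n. z i + z' (inv' t i)) = (\<Sum>i=1..n. z i) + (\<Sum>i=1..n. z' i)"
      using sum.permute[OF permutes_inv[OF t(1)], of z'] by (simp add: sum.distrib o_def)
    finally show ?thesis
      using t sign_compose[of t t']
      by (simp add: xy \<chi>_def colored_perm_group_simps power_add permutes_imp_permutation[of "{1..n}"])
  qed
  moreover have "\<chi> x \<in> {-1, 1}" for x
    by (cases x) (simp add: \<chi>_def sign_def minus_one_power_iff)
  ultimately have "\<chi> \<in> hom (colored_perm_group r n) sign_img"
    by (simp add: hom_def sign_img_def)
  moreover have "\<chi> (s_gen i) = -1" if "i < n" for i
    using that by (auto simp: \<chi>_def s_gen_def sign_swap_id)
  ultimately show ?thesis by blast
qed

lemma word_value_carrier:
  assumes "group G" "\<And>x. x \<in> set w \<Longrightarrow> f x \<in> carrier G"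
  shows "word_value G f w \<in> carrier G"
proof -
  interpret group G by fact
  show ?thesis using assms(2) by (induction w) (auto simp: word_value_def)
qed

lemma coloring_part_letters:
  assumes "x \<in> set (coloring_part n \<pi>)"
  shows "x < n"
proof -
  have "\<exists>i\<in>set [1..<n+1]. x \<in> set (rev [1..<i] @ replicate (digit_color \<pi> i) 0)"
    using assms by (simp only: coloring_part_def set_concat set_map set_filter) blast
  then obtain i where "i \<in> set [1..<n+1]" "x \<in> set (rev [1..<i] @ replicate (digit_color \<pi> i) 0)"
    by blast
  then show ?thesis by (auto simp del: upt_Suc)
qed

lemma colored_part_carrier:
  assumes "r > 1"
  shows "colored_part r n \<pi> \<in> carrier (colored_perm_group r n)"
proof -
  have "group (colored_perm_group r n)"
    using assms by (intro colored_perm_group_is_group) simp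
  then show ?thesis
    unfolding colored_part_def
    by (rule word_value_carrier) (rule s_gen_carrier[OF assms coloring_part_letters])
qed

lemma place_in_range:
  assumes "\<sigma> \<in> carrier (colored_perm_group r n)" "\<rho> \<in> carrier (colored_perm_group r n)"
    and "k \<in> {1..n}"
  shows "inv' (snd \<rho>) (snd \<sigma> k) \<in> {1..n}"
proof -
  have "snd \<sigma> permutes {1..n}" "snd \<rho> permutes {1..n}"
    using assms(1,2) by (auto simp: colored_perm_group_def)
  then show ?thesis
    using assms(3) by (simp only: permutes_in_image permutes_inv)
qed

lemma sort_state_carrier:
  assumes "r > 1" "\<pi> \<in> carrier (colored_perm_group r n)" "k \<le> n"
  shows "sort_state r n \<pi> k \<in> carrier (colored_perm_group r n)"
  using assms(3)
proof (induction k)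
  case 0
  then show ?case using assms by simp
next
  case (Suc k)
  interpret group "colored_perm_group r n"
    using assms by (intro colored_perm_group_is_group) simp
  have "i < n" if "i \<in> set (sort_word (colored_part r n \<pi>) (sort_state r n \<pi> k) (Suc k))" for i
    using that place_in_range[OF colored_part_carrier Suc.IH, of "Suc k" \<pi>] assms(1) Suc.prems
    by (auto simp: sort_word_def)
  then show ?case
    using Suc assms(1) by (simp add: word_value_carrier s_gen_carrier)
qed

lemma ordering_part_letters:
  assumes "r > 1" "\<pi> \<in> carrier (colored_perm_group r n)"
  shows "ordering_part r n \<pi> \<in> lists {1..<n}"
proof -
  have "i \<in> {1..<n}" if "k \<in> {1..<n}" "i \<in> set (sort_factor r n \<pi> k)" for i k
  proof -
    have "k - 1 \<le> n" "k \<in> {1..n}" using that(1) by auto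
    from place_in_range[OF colored_part_carrier[OF assms(1)] sort_state_carrier[OF assms this(1)] this(2), of \<pi>]
    have "inv' (snd (sort_state r n \<pi> (k - 1))) (snd (colored_part r n \<pi>) k) \<le> n"
      by (simp only: atLeastAtMost_iff)
    moreover have "k \<le> i" "i < inv' (snd (sort_state r n \<pi> (k - 1))) (snd (colored_part r n \<pi>) k)"
      using that(2) by (simp_all add: sort_factor_def sort_word_def)
    ultimately show ?thesis
      using that(1) by (simp only: atLeastLessThan_iff) linarith
  qed
  note sub = this
  show ?thesis
    unfolding ordering_part_def in_lists_conv_set set_concat set_map set_rev set_upt
  proof
    fix x
    assume "x \<in> \<Union> (set ` (\<lambda>k. rev (sort_factor r n \<pi> k)) ` {1..<n})"
    then obtain k where "k \<in> {1..<n}" "x \<in> set (rev (sort_factor r n \<pi> k))" by blast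
    then show "x \<in> {1..<n}" using sub[of k x] by (simp only: set_rev)
  qed
qed

lemma canonical_word_blocks:
  assumes "n > 0"
  shows "canonical_word r n \<pi> =
    concat (map (\<lambda>i. replicate (digit_color \<pi> i) 0 @ canonical_block r n \<pi> i) [1..<n+1])"
proof -
  define B where "B i = (if digit_color \<pi> i \<noteq> 0 then rev [1..<i] else [])" for i
  define R where "R i = replicate (digit_color \<pi> i) (0::nat)" for i
  have upt: "[1..<Suc m + 1] = [1..<m+1] @ [Suc m]" for m :: nat
    by simp
  have col: "coloring_part m \<pi> = concat (map (\<lambda>i. B i @ R i) [1..<m+1])" for m
  proof (induction m)
    case 0
    then show ?case by (simp add: coloring_part_def)
  next
    case (Suc m)
    have "coloring_part (Suc m) \<pi> = coloring_part m \<pi> @ B (Suc m) @ R (Suc m)"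
      unfolding coloring_part_def upt filter_append map_append concat_append
      by (simp add: B_def R_def del: upt_Suc)
    then show ?case
      unfolding upt map_append concat_append Suc.IH by simp
  qed
  have shift: "concat (map (\<lambda>i. B i @ R i) [1..<m+1]) @ B (m + 1) =
      concat (map (\<lambda>i. R i @ B (i + 1)) [1..<m+1])" for m
  proof (induction m)
    case 0
    then show ?case by (simp add: B_def)
  next
    case (Suc m)
    show ?case
      unfolding upt map_append concat_append Suc.IH[symmetric] by (simp del: upt_Suc)
  qed
  obtain m where n: "n = Suc m" using assms by (cases n) auto
  have "canonical_word r n \<pi> =
      (concat (map (\<lambda>i. B i @ R i) [1..<m+1]) @ B (m + 1)) @ R n @ ordering_part r n \<pi>"
    unfolding canonical_word_def col n upt map_append concat_append by simp
  also have "\<dots> = concat (map (\<lambda>i. R i @ B (i + 1)) [1..<m+1]) @ R n @ ordering_part r n \<pi>"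
    by (simp only: shift)
  also have "map (\<lambda>i. R i @ B (i + 1)) [1..<m+1] = map (\<lambda>i. R i @ canonical_block r n \<pi> i) [1..<m+1]"
    by (rule map_cong[OF refl]) (simp add: B_def canonical_block_def n del: upt_Suc)
  also have "concat \<dots> @ R n @ ordering_part r n \<pi> =
      concat (map (\<lambda>i. R i @ canonical_block r n \<pi> i) [1..<n+1])"
    unfolding n upt map_append concat_append by (simp add: canonical_block_def del: upt_Suc)
  finally show ?thesis
    unfolding R_def .
qed

lemma canonical_block_letters:
  assumes "r > 1" "\<pi> \<in> carrier (colored_perm_group r n)" "i \<in> {1..n}"
  shows "canonical_block r n \<pi> i \<in> lists {1..<n}"
proof (cases "i = n")
  case True
  then show ?thesis
    using ordering_part_letters[OF assms(1,2)] by (simp only: canonical_block_def refl if_True)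
next
  case False
  then have "set [1..<i+1] \<subseteq> {1..<n}"
    using assms(3) by (simp only: set_upt) auto
  then show ?thesis
    using False by (simp add: canonical_block_def in_lists_conv_set subset_iff del: upt_Suc)
qed

lemma s_gen_0_pow:
  assumes "r > 0"
  shows "s_gen 0 [^]\<^bsub>colored_perm_group r n\<^esub> (k::nat) = (\<lambda>j. if j = 1 then k mod r else 0, id)"
  by (induction k)
    (use assms in \<open>auto simp: s_gen_def colored_perm_group_simps nat_pow_def colored_perm_group_def mod_simps fun_eq_iff\<close>)

text \<open>The rewriting rules of the translation hold in the group.\<close>

lemma left_right_factor_value:
  assumes "r mod 4 = 2" "i < n"
  defines "G \<equiv> colored_perm_group r n"
  shows "word_value G (a_letter_value r n) (left_factor r i) =
           s_gen i \<otimes>\<^bsub>G\<^esub> (s_gen 0 [^]\<^bsub>G\<^esub> (r div 2))" (is ?L)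
    and "word_value G (a_letter_value r n) (right_factor r i) =
           (s_gen 0 [^]\<^bsub>G\<^esub> (r div 2)) \<otimes>\<^bsub>G\<^esub> s_gen i" (is ?R)
proof -
  have r: "r > 1" using assms(1) by presburger
  interpret group G unfolding G_def using r by (intro colored_perm_group_is_group) simp
  have c: "s_gen j \<in> carrier G" if "j < n" for j
    using that r by (simp add: G_def s_gen_carrier)
  have c0: "s_gen 0 \<in> carrier G" using c assms(2) by simp
  let ?h = "s_gen 0 [^]\<^bsub>G\<^esub> (r div 2)"
  have hh: "?h \<otimes>\<^bsub>G\<^esub> ?h = \<one>\<^bsub>G\<^esub>"
  proof -
    have "?h \<otimes>\<^bsub>G\<^esub> ?h = s_gen 0 [^]\<^bsub>G\<^esub> (r div 2 + r div 2)"
      using c0 by (simp add: nat_pow_mult)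
    also have "r div 2 + r div 2 = r" using assms(1) by presburger
    also have "s_gen 0 [^]\<^bsub>G\<^esub> r = \<one>\<^bsub>G\<^esub>"
      using r unfolding G_def by (simp add: s_gen_0_pow colored_perm_group_simps fun_eq_iff)
    finally show ?thesis .
  qed
  have a0: "word_value G (a_letter_value r n) (replicate k a0) = s_gen 0 [^]\<^bsub>G\<^esub> (2 * k)" for k
  proof (induction k)
    case 0
    then show ?case by (simp add: word_value_def)
  next
    case (Suc k)
    then show ?case
      using c0 by (simp add: word_value_def a_letter_value_def a_gen_def nat_pow_mult
          int_pow_1 flip: G_def)
  qed
  have a: "word_value G (a_letter_value r n) [(j, 1)] = ?h \<otimes>\<^bsub>G\<^esub> s_gen j" if "0 < j" "j < n" for j
    using that c c0
    by (simp add: word_value_def a_letter_value_def a_gen_def int_pow_1 flip: G_def)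
  have "2 * ((r + 2) div 4) = Suc (r div 2)" using assms(1) by presburger
  then have e: "2 * (Suc (Suc r) div 4) = Suc (r div 2)" by simp
  show ?R
  proof (cases "i = 0")
    case True
    then show ?thesis by (simp add: right_factor_def a0 e)
  next
    case False
    then show ?thesis using a assms(2) by (simp add: right_factor_def)
  qed
  consider "i = 0" | "i = 1" | "i \<ge> 2" by linarith
  then show ?L
  proof cases
    case 1
    have "word_value G (a_letter_value r n) (left_factor r i) = s_gen 0 [^]\<^bsub>G\<^esub> Suc (r div 2)"
      using 1 by (simp add: left_factor_def a0 e)
    then show ?thesis
      unfolding 1 nat_pow_Suc2[OF c0] .
  next
    case 2
    have s: "s_gen 1 \<otimes>\<^bsub>G\<^esub> s_gen 1 = \<one>\<^bsub>G\<^esub>"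
      by (simp add: G_def s_gen_def colored_perm_group_simps)
    have "(s_gen 1 \<otimes>\<^bsub>G\<^esub> ?h) \<otimes>\<^bsub>G\<^esub> (?h \<otimes>\<^bsub>G\<^esub> s_gen 1) = s_gen 1 \<otimes>\<^bsub>G\<^esub> (?h \<otimes>\<^bsub>G\<^esub> ?h) \<otimes>\<^bsub>G\<^esub> s_gen 1"
      using c c0 2 assms(2) by (simp add: m_assoc)
    then have "(s_gen 1 \<otimes>\<^bsub>G\<^esub> ?h) \<otimes>\<^bsub>G\<^esub> (?h \<otimes>\<^bsub>G\<^esub> s_gen 1) = \<one>\<^bsub>G\<^esub>"
      using c c0 2 assms(2) s by (simp only: hh) simp
    then have "inv\<^bsub>G\<^esub> (?h \<otimes>\<^bsub>G\<^esub> s_gen 1) = s_gen 1 \<otimes>\<^bsub>G\<^esub> ?h"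
      using c c0 2 assms(2) by (intro inv_equality) auto
    then show ?thesis
      using 2 c c0 assms(2)
      by (simp add: left_factor_def word_value_def a_letter_value_def a_gen_def int_pow_neg
          int_pow_1 flip: G_def)
  next
    case 3
    have "s_gen i \<otimes>\<^bsub>G\<^esub> ?h = ?h \<otimes>\<^bsub>G\<^esub> s_gen i"
    proof -
      have "inv' (transpose i (Suc i)) j = 1 \<longleftrightarrow> j = 1" for j
        using 3 by (auto simp: transpose_def)
      moreover have "s_gen i = (\<lambda>_. 0, transpose i (Suc i))"
        using 3 by (simp add: s_gen_def)
      ultimately show ?thesis
        using r unfolding G_def by (simp add: s_gen_0_pow colored_perm_group_simps)
    qed
    then show ?thesis
      using 3 a assms(2) by (simp add: left_factor_def)
  qed
qed

end

theory Submission
  imports Defs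
begin

text \<open>
  Since \<open>r/2\<close> is odd, both factors of a pair translate \<open>s\<^sub>0\<close> into \<open>a\<^sub>0\<close> to the power \<open>(r+2)/4\<close>, which is
  the inverse of 2 modulo \<open>r/2\<close>; a maximal run \<open>s\<^sub>0^z\<close> therefore becomes \<open>a\<^sub>0\<close> to the power \<open>z \<oslash> 2\<close>
  wherever the word is cut, while every other letter becomes one letter. For the length, the
  ordering part is a bubble sort of \<open>|\<sigma>|\<^sup>-\<^sup>1|\<pi>|\<close>, and each of its letters removes one inversion. The same
  sorting identity, evaluated under the character, shows that the canonical word of an element of
  the alternating subgroup has even length.
\<close>

section \<open>Words and the character\<close>

lemma word_value_simps [simp]:
  "word_value G f [] = \<one>\<^bsub>G\<^esub>"
  "word_value G f (x # w) = f x \<otimes>\<^bsub>G\<^esub> word_value G f w"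
  by (simp_all add: word_value_def)

lemma (in group) word_value_append:
  assumes "\<And>x. x \<in> set u \<union> set v \<Longrightarrow> f x \<in> carrier G"
  shows "word_value G f (u @ v) = word_value G f u \<otimes> word_value G f v"
  using assms
proof (induction u)
  case Nil
  then show ?case using word_value_carrier[OF is_group, of v f] by simp
next
  case (Cons x u)
  have "word_value G f u \<in> carrier G" "word_value G f v \<in> carrier G" "f x \<in> carrier G"
    using Cons.prems by (auto intro!: word_value_carrier is_group)
  with Cons show ?case by (simp add: m_assoc)
qed

text \<open>\<open>alt_character\<close> is a choice by \<open>SOME\<close>; everything below rests
  on these two properties of it.\<close>

lemma alt_character_props:
  assumes "even r" "r > 0"
  shows "alt_character r n \<in> hom (colored_perm_group r n) sign_img"
    and "i < n \<Longrightarrow> alt_character r n (s_gen i) = -1"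
  using someI_ex[OF alt_character_exists[OF assms, of n]]
  unfolding alt_character_def by blast+

lemma alt_character_mult:
  assumes "even r" "r > 0"
    and "x \<in> carrier (colored_perm_group r n)" "y \<in> carrier (colored_perm_group r n)"
  shows "alt_character r n (x \<otimes>\<^bsub>colored_perm_group r n\<^esub> y) =
    alt_character r n x * alt_character r n y"
  using hom_mult[OF alt_character_props(1)[OF assms(1,2)] assms(3,4)] by (simp add: sign_img_def)

text \<open>Every generator has character -1, so a group element determines the parity of the length
  of any word for it.\<close>

lemma alt_character_word_value:
  assumes "even r" "r > 0" "set w \<subseteq> {..<n}"
  shows "alt_character r n (word_value (colored_perm_group r n) s_gen w) = (-1) ^ length w"
proof -
  let ?G = "colored_perm_group r n"
  interpret group ?G by (rule colored_perm_group_is_group[OF assms(2)])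
  interpret S: group sign_img by (rule sign_img_is_group)
  have r: "r > 1" using assms(1,2) by presburger
  show ?thesis
    using assms(3)
  proof (induction w)
    case Nil
    have "alt_character r n \<one>\<^bsub>?G\<^esub> = \<one>\<^bsub>sign_img\<^esub>"
      by (rule hom_one[OF alt_character_props(1)[OF assms(1,2)] is_group S.is_group])
    then show ?case by (simp add: sign_img_def)
  next
    case (Cons i w)
    have "word_value ?G s_gen w \<in> carrier ?G" "s_gen i \<in> carrier ?G"
      using Cons.prems r by (auto intro!: word_value_carrier is_group s_gen_carrier)
    with Cons show ?case
      by (simp add: alt_character_mult assms alt_character_props(2))
  qed
qed


section \<open>Moving a digit to an earlier place\<close>

text \<open>\<open>cyc k p\<close> is the permutation of places represented by the word \<open>rev [k..<p]\<close>.\<close>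

definition cyc :: "nat \<Rightarrow> nat \<Rightarrow> nat \<Rightarrow> nat" where
  "cyc k p j = (if j = k then p else if k < j \<and> j \<le> p then j - 1 else j)"

lemma cyc_same [simp]: "cyc k k = id"
  by (auto simp: cyc_def fun_eq_iff)

text \<open>The word \<open>rev [k..<Suc p]\<close> starts with the letter \<open>p\<close>. Peeling
  it off gives this recursion, which drives the inductions over \<open>p\<close> below.\<close>

lemma cyc_Suc:
  assumes "k \<le> p"
  shows "cyc k (Suc p) = transpose p (Suc p) \<circ> cyc k p"
  using assms by (auto simp: cyc_def fun_eq_iff transpose_def)

lemma cyc_permutes:
  assumes "m \<le> k" "k \<le> p" "p \<le> n"
  shows "cyc k p permutes {m..n}"
  using assms(2,1,3)
proof (induction p rule: dec_induct)
  case base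
  show ?case unfolding cyc_same by (rule permutes_id)
next
  case (step p)
  have "transpose p (Suc p) permutes {m..n}"
    using step by (intro permutes_swap_id) auto
  then show ?case
    unfolding cyc_Suc[OF step.hyps(1)] using step by (intro permutes_compose) auto
qed

text \<open>Colors are attached to digits, so right multiplication by a generator with zero color
  vector only exchanges two places. Reduction mod \<open>r\<close> is harmless because colors in the
  carrier are below \<open>r\<close>.\<close>

lemma mult_s_gen:
  assumes "\<rho> \<in> carrier (colored_perm_group r n)" "r > 0" "0 < i"
  shows "\<rho> \<otimes>\<^bsub>colored_perm_group r n\<^esub> s_gen i = (fst \<rho>, snd \<rho> \<circ> transpose i (Suc i))"
  using assms carrier_color_less[of "fst \<rho>" "snd \<rho>" r n]
  by (cases \<rho>) (simp add: s_gen_def colored_perm_group_simps)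

text \<open>The digit in place \<open>p\<close> moves to place \<open>k\<close> and those passed
  shift right by one. The first letter is absorbed into \<open>\<rho>\<close>, which is therefore
  arbitrary in the induction.\<close>

lemma mult_descending_word:
  assumes "\<rho> \<in> carrier (colored_perm_group r n)" "r > 1" "0 < k" "k \<le> p" "p \<le> n"
  shows "\<rho> \<otimes>\<^bsub>colored_perm_group r n\<^esub> word_value (colored_perm_group r n) s_gen (rev [k..<p]) =
    (fst \<rho>, snd \<rho> \<circ> cyc k p)"
  using assms(4,1,5)
proof (induction p arbitrary: \<rho> rule: dec_induct)
  case base
  interpret group "colored_perm_group r n" using assms by (intro colored_perm_group_is_group) simp
  show ?case using base by simp
next
  case (step p)
  let ?G = "colored_perm_group r n"
  interpret group ?G using assms by (intro colored_perm_group_is_group) simp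
  have s: "s_gen p \<in> carrier ?G" using step assms by (intro s_gen_carrier) auto
  have w: "word_value ?G s_gen (rev [k..<p]) \<in> carrier ?G"
    using step assms by (intro word_value_carrier is_group s_gen_carrier) auto
  have "\<rho> \<otimes>\<^bsub>?G\<^esub> word_value ?G s_gen (rev [k..<Suc p]) =
      (\<rho> \<otimes>\<^bsub>?G\<^esub> s_gen p) \<otimes>\<^bsub>?G\<^esub> word_value ?G s_gen (rev [k..<p])"
    using step.prems step.hyps(1) s w by (simp add: m_assoc)
  also have "\<dots> = (fst (\<rho> \<otimes>\<^bsub>?G\<^esub> s_gen p), snd (\<rho> \<otimes>\<^bsub>?G\<^esub> s_gen p) \<circ> cyc k p)"
    using step s by (intro step.IH) auto
  also have "\<dots> = (fst \<rho>, snd \<rho> \<circ> cyc k (Suc p))"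
    using step assms by (simp add: mult_s_gen cyc_Suc comp_assoc)
  finally show ?case .
qed

section \<open>Inversions of ordinary permutations\<close>

definition perm_inv :: "nat \<Rightarrow> (nat \<Rightarrow> nat) \<Rightarrow> nat" where
  "perm_inv n q = card {(i, j). i \<in> {1..n} \<and> j \<in> {1..n} \<and> i < j \<and> q j < q i}"

lemma perm_inv_id:
  assumes "\<And>i. i \<in> {1..n} \<Longrightarrow> q i = i"
  shows "perm_inv n q = 0"
proof -
  have "{(i, j). i \<in> {1..n} \<and> j \<in> {1..n} \<and> i < j \<and> q j < q i} = {}"
    using assms by fastforce
  then show ?thesis by (simp only: perm_inv_def card.empty)
qed

text \<open>The exchange \<open>t\<close> of the two places preserves the order of every other pair
  of places. It therefore matches the inversions of \<open>q \<circ> t\<close> with those of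
  \<open>q\<close>, apart from \<open>(p, Suc p)\<close>, which is an inversion of \<open>q\<close>
  only.\<close>

lemma perm_inv_descent:
  assumes "q (Suc p) < q p" "1 \<le> p" "Suc p \<le> n"
  shows "Suc (perm_inv n (q \<circ> transpose p (Suc p))) = perm_inv n q"
proof -
  define t where "t = transpose p (Suc p)"
  define I where "I f = {(i, j). i \<in> {1..n} \<and> j \<in> {1..n} \<and> i < j \<and> f j < f i}"
    for f :: "nat \<Rightarrow> nat"
  have fin: "finite (I f)" for f
    by (rule finite_subset[of _ "{1..n} \<times> {1..n}"]) (auto simp: I_def)
  have tt: "t (t i) = i" for i by (simp add: t_def)
  have tr: "t i \<in> {1..n} \<longleftrightarrow> i \<in> {1..n}" for i
    using assms by (auto simp: t_def transpose_def)
  have mono: "t i < t j" if "i < j" "(i, j) \<noteq> (p, Suc p)" for i j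
    using that by (auto simp: t_def transpose_def)
  have tp: "t p = Suc p" "t (Suc p) = p" by (simp_all add: t_def)
  have "bij_betw (map_prod t t) (I (q \<circ> t)) (I q - {(p, Suc p)})"
  proof (rule bij_betw_byWitness[where f' = "map_prod t t"])
    show "\<forall>a\<in>I (q \<circ> t). map_prod t t (map_prod t t a) = a"
      "\<forall>a\<in>I q - {(p, Suc p)}. map_prod t t (map_prod t t a) = a"
      by (auto simp: tt)
    show "map_prod t t ` I (q \<circ> t) \<subseteq> I q - {(p, Suc p)}"
    proof (rule image_subsetI)
      fix a assume "a \<in> I (q \<circ> t)"
      then obtain i j where a: "a = (i, j)" and ij: "(i, j) \<in> I (q \<circ> t)" by (cases a) auto
      then have "(i, j) \<noteq> (p, Suc p)" using assms(1) tp by (auto simp: I_def)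
      moreover have "(t i, t j) \<noteq> (p, Suc p)"
      proof
        assume "(t i, t j) = (p, Suc p)"
        then have "i = Suc p" "j = p" using tt tp by (metis prod.inject)+
        then show False using ij by (simp add: I_def)
      qed
      ultimately show "map_prod t t a \<in> I q - {(p, Suc p)}"
        using a ij mono[of i j] tr[of i] tr[of j] by (simp add: I_def)
    qed
    show "map_prod t t ` (I q - {(p, Suc p)}) \<subseteq> I (q \<circ> t)"
      using mono tr by (auto simp: I_def tt)
  qed
  then have "card (I (q \<circ> t)) = card (I q - {(p, Suc p)})" by (rule bij_betw_same_card)
  moreover have "(p, Suc p) \<in> I q" using assms by (simp add: I_def)
  ultimately have "Suc (card (I (q \<circ> t))) = card (I q)"
    using fin by (metis card_Suc_Diff1)
  then show ?thesis by (simp add: perm_inv_def I_def t_def)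
qed

text \<open>The entry in place \<open>p\<close> is smaller than each of the \<open>p - k\<close>
  entries it passes, so every adjacent exchange on its way is a descent and removes one
  inversion.\<close>

lemma perm_inv_cyc:
  assumes "1 \<le> k" "k \<le> p" "p \<le> n" "\<And>j. j \<in> {k..<p} \<Longrightarrow> q p < q j"
  shows "perm_inv n (q \<circ> cyc k p) + (p - k) = perm_inv n q"
  using assms(2,3,4)
proof (induction p arbitrary: q rule: dec_induct)
  case base
  then show ?case by simp
next
  case (step p)
  let ?q = "q \<circ> transpose p (Suc p)"
  have "perm_inv n (?q \<circ> cyc k p) + (p - k) = perm_inv n ?q"
  proof (rule step.IH)
    fix j assume "j \<in> {k..<p}"
    then show "?q p < ?q j" using step.prems(2)[of j] by (simp add: transpose_def)
  qed (use step in auto)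
  moreover have "Suc (perm_inv n ?q) = perm_inv n q"
    using step assms(1) by (intro perm_inv_descent) auto
  ultimately show ?case
    unfolding cyc_Suc[OF step.hyps(1)] comp_assoc[symmetric] using step.hyps(1) by linarith
qed


section \<open>The coloring part\<close>

lemma coloring_part_Suc:
  "coloring_part (Suc m) \<pi> = coloring_part m \<pi> @
     (if digit_color \<pi> (Suc m) \<noteq> 0
      then rev [1..<Suc m] @ replicate (digit_color \<pi> (Suc m)) 0 else [])"
proof -
  have "[1..<Suc m + 1] = [1..<m + 1] @ [Suc m]" by simp
  then show ?thesis
    unfolding coloring_part_def by (simp del: upt_Suc)
qed

lemma word_value_replicate_0:
  assumes "r > 1"
  shows "word_value (colored_perm_group r n) s_gen (replicate c 0) =
    (\<lambda>j. if j = 1 then c mod r else 0, id)"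
proof (induction c)
  case 0
  then show ?case by (simp add: colored_perm_group_simps fun_eq_iff)
next
  case (Suc c)
  then show ?case
    by (auto simp: s_gen_def colored_perm_group_simps mod_simps fun_eq_iff)
qed

text \<open>Induction on the number of digits treated, inside the fixed group for \<open>n\<close>.
  A colored digit \<open>Suc m\<close> lies below all smaller digits in the length order: its word
  brings it to place 1, where the power of \<open>s_0\<close> colors it. An uncolored one lies above
  them and stays last.\<close>

lemma coloring_part_value:
  assumes "r > 1" "\<pi> \<in> carrier (colored_perm_group r n)" "m \<le> n"
  shows "\<exists>\<tau>. word_value (colored_perm_group r n) s_gen (coloring_part m \<pi>) =
      (\<lambda>i. if i \<le> m then digit_color \<pi> i else 0, \<tau>) \<and> \<tau> permutes {1..m} \<and>
    (\<forall>i j. 1 \<le> i \<longrightarrow> i < j \<longrightarrow> j \<le> m \<longrightarrow>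
      length_less (\<tau> i, digit_color \<pi> (\<tau> i)) (\<tau> j, digit_color \<pi> (\<tau> j)))"
  using assms(3)
proof (induction m)
  case 0
  \<comment> \<open>The index 0 lies outside \<open>{1..n}\<close>, where color vectors
    vanish.\<close>
  have "(\<lambda>i. if i \<le> 0 then digit_color \<pi> i else 0) = (\<lambda>_. 0)"
    using assms(2) by (cases \<pi>) (auto simp: colored_perm_group_simps digit_color_def fun_eq_iff)
  then show ?case
    by (simp add: coloring_part_def colored_perm_group_simps permutes_id)
next
  case (Suc m)
  let ?G = "colored_perm_group r n"
  let ?z = "digit_color \<pi>"
  interpret group ?G using assms by (intro colored_perm_group_is_group) simp
  have zless: "?z i < r" for i
    using carrier_color_less[of "fst \<pi>" "snd \<pi>"] assms(1,2) by (simp add: digit_color_def)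
  obtain \<tau> where val: "word_value ?G s_gen (coloring_part m \<pi>) =
      (\<lambda>i. if i \<le> m then ?z i else 0, \<tau>)" and \<tau>: "\<tau> permutes {1..m}"
    and sorted: "\<And>i j. 1 \<le> i \<Longrightarrow> i < j \<Longrightarrow> j \<le> m \<Longrightarrow>
      length_less (\<tau> i, ?z (\<tau> i)) (\<tau> j, ?z (\<tau> j))"
    using Suc by (metis Suc_leD)
  have \<tau>S: "\<tau> permutes {1..Suc m}" using \<tau> by (rule permutes_subset) auto
  have \<tau>m: "\<tau> (Suc m) = Suc m" using \<tau> by (simp add: permutes_not_in)
  have \<tau>_in: "1 \<le> \<tau> i \<and> \<tau> i \<le> m" if "1 \<le> i" "i \<le> m" for i
    using that permutes_in_image[OF \<tau>, of i] by simp
  show ?case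
  proof (cases "?z (Suc m) = 0")
    case True
    have "length_less (\<tau> i, ?z (\<tau> i)) (\<tau> j, ?z (\<tau> j))"
      if "1 \<le> i" "i < j" "j \<le> Suc m" for i j
    proof (cases "j = Suc m")
      case j: True
      then show ?thesis
        using that True \<tau>m \<tau>_in[of i] by (simp add: length_less_def)
    next
      case False
      then show ?thesis using that sorted by simp
    qed
    moreover have "(\<lambda>i. if i \<le> m then ?z i else 0) = (\<lambda>i. if i \<le> Suc m then ?z i else 0)"
      using True by (auto simp: fun_eq_iff le_Suc_eq)
    ultimately show ?thesis
      using True val \<tau>S by (auto simp: coloring_part_Suc)
  next
    case False
    let ?\<rho> = "(\<lambda>i. if i \<le> m then ?z i else 0, \<tau>)"
    let ?\<upsilon> = "\<tau> \<circ> cyc 1 (Suc m)"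
    have cp: "cyc 1 (Suc m) permutes {1..Suc m}" by (rule cyc_permutes) auto
    have \<upsilon>: "?\<upsilon> permutes {1..Suc m}" using cp \<tau>S by (rule permutes_compose)
    have gens: "s_gen i \<in> carrier ?G" if "i < n" for i using that assms(1) by (simp add: s_gen_carrier)
    have letters: "i < n" if "i \<in> set (coloring_part m \<pi>)" for i
      using coloring_part_letters[OF that] Suc.prems by simp
    have \<rho>: "?\<rho> \<in> carrier ?G"
      unfolding val[symmetric] using letters gens by (intro word_value_carrier is_group) auto
    have W: "word_value ?G s_gen (rev [1..<Suc m]) \<in> carrier ?G"
      using gens Suc.prems by (intro word_value_carrier is_group) auto
    have Z: "word_value ?G s_gen (replicate (?z (Suc m)) 0) \<in> carrier ?G"
      using gens Suc.prems by (intro word_value_carrier is_group) auto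
    have letters3: "s_gen i \<in> carrier ?G"
      if "i \<in> set (coloring_part m \<pi>) \<union> (set (rev [1..<Suc m]) \<union> set (replicate (?z (Suc m)) 0))"
      for i
      using that letters Suc.prems by (intro gens) (auto simp del: upt_Suc split: if_splits)
    have "word_value ?G s_gen (coloring_part (Suc m) \<pi>) =
        word_value ?G s_gen (coloring_part m \<pi> @ rev [1..<Suc m] @ replicate (?z (Suc m)) 0)"
      using False by (simp only: coloring_part_Suc simp_thms if_True append_assoc)
    also have "\<dots> = word_value ?G s_gen (coloring_part m \<pi>) \<otimes>\<^bsub>?G\<^esub>
        word_value ?G s_gen (rev [1..<Suc m] @ replicate (?z (Suc m)) 0)"
      by (rule word_value_append) (use letters3 in \<open>unfold set_append, blast\<close>)
    also have "word_value ?G s_gen (rev [1..<Suc m] @ replicate (?z (Suc m)) 0) =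
        word_value ?G s_gen (rev [1..<Suc m]) \<otimes>\<^bsub>?G\<^esub>
          word_value ?G s_gen (replicate (?z (Suc m)) 0)"
      by (rule word_value_append) (use letters3 in blast)
    also note val
    also have "?\<rho> \<otimes>\<^bsub>?G\<^esub> (word_value ?G s_gen (rev [1..<Suc m]) \<otimes>\<^bsub>?G\<^esub>
          word_value ?G s_gen (replicate (?z (Suc m)) 0)) =
        ?\<rho> \<otimes>\<^bsub>?G\<^esub> word_value ?G s_gen (rev [1..<Suc m]) \<otimes>\<^bsub>?G\<^esub>
          word_value ?G s_gen (replicate (?z (Suc m)) 0)"
      by (rule m_assoc[OF \<rho> W Z, symmetric])
    also have "?\<rho> \<otimes>\<^bsub>?G\<^esub> word_value ?G s_gen (rev [1..<Suc m]) =
        (\<lambda>i. if i \<le> m then ?z i else 0, ?\<upsilon>)"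
      using mult_descending_word[OF \<rho> assms(1), of 1 "Suc m"] Suc.prems by (simp del: upt_Suc)
    also have "\<dots> \<otimes>\<^bsub>?G\<^esub> word_value ?G s_gen (replicate (?z (Suc m)) 0) =
        (\<lambda>i. if i \<le> Suc m then ?z i else 0, ?\<upsilon>)"
    proof -
      \<comment> \<open>The product adds the color of the power of \<open>s_0\<close> to the digit
        in place 1. This is now \<open>Suc m\<close>, whose color so far is 0.\<close>
      have "?\<upsilon> 1 = Suc m" using \<tau>m by (simp add: cyc_def)
      then have "inv' ?\<upsilon> i = 1 \<longleftrightarrow> i = Suc m" for i
        using permutes_inverses[OF \<upsilon>] by metis
      then show ?thesis
        using zless assms(1) Suc.prems
        by (auto simp: word_value_replicate_0 colored_perm_group_simps fun_eq_iff le_Suc_eq)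
    qed
    finally have "word_value ?G s_gen (coloring_part (Suc m) \<pi>) =
      (\<lambda>i. if i \<le> Suc m then ?z i else 0, ?\<upsilon>)" .
    moreover have "length_less (?\<upsilon> i, ?z (?\<upsilon> i)) (?\<upsilon> j, ?z (?\<upsilon> j))"
      if "1 \<le> i" "i < j" "j \<le> Suc m" for i j
    proof (cases "i = 1")
      case True
      have "?\<upsilon> j = \<tau> (j - 1)" using that True by (simp add: cyc_def)
      moreover have "?\<upsilon> 1 = Suc m" using \<tau>m by (simp add: cyc_def)
      moreover have "\<tau> (j - 1) \<le> m" using that True \<tau>_in[of "j - 1"] by force
      ultimately show ?thesis
        using True False by (simp add: length_less_def)
    next
      case False
      then show ?thesis using that sorted[of "i - 1" "j - 1"] by (simp add: cyc_def)
    qed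
    ultimately show ?thesis using \<upsilon> by blast
  qed
qed

text \<open>The case \<open>m = n\<close> of \<open>coloring_part_value\<close>. Color vectors
  vanish beyond \<open>n\<close>, so the cut-off disappears: \<open>\<sigma>\<close> is
  \<open>\<pi>\<close> with its window sorted.\<close>

lemma colored_part_props:
  assumes "r > 1" "\<pi> \<in> carrier (colored_perm_group r n)"
  shows "fst (colored_part r n \<pi>) = fst \<pi>"
    and "snd (colored_part r n \<pi>) permutes {1..n}"
    and "\<lbrakk>1 \<le> i; i < j; j \<le> n\<rbrakk> \<Longrightarrow>
      length_less (window (colored_part r n \<pi>) i) (window (colored_part r n \<pi>) j)"
proof -
  obtain \<tau> where 1: "colored_part r n \<pi> = (\<lambda>i. if i \<le> n then digit_color \<pi> i else 0, \<tau>)"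
    and 2: "\<tau> permutes {1..n}"
    and 3: "\<And>i j. 1 \<le> i \<Longrightarrow> i < j \<Longrightarrow> j \<le> n \<Longrightarrow>
      length_less (\<tau> i, digit_color \<pi> (\<tau> i)) (\<tau> j, digit_color \<pi> (\<tau> j))"
    using coloring_part_value[OF assms order_refl] unfolding colored_part_def by blast
  show f: "fst (colored_part r n \<pi>) = fst \<pi>"
    using assms(2) 1 by (cases \<pi>) (auto simp: colored_perm_group_simps digit_color_def fun_eq_iff)
  show "snd (colored_part r n \<pi>) permutes {1..n}" using 1 2 by simp
  assume ij: "1 \<le> i" "i < j" "j \<le> n"
  then show "length_less (window (colored_part r n \<pi>) i) (window (colored_part r n \<pi>) j)"
    using 3[OF ij] f 1 by (simp add: window_def digit_color_def)
qed


section \<open>The ordering part\<close>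

lemma length_less_asym: "length_less x y \<Longrightarrow> \<not> length_less y x"
  by (auto simp: length_less_def split: prod.splits if_splits)

text \<open>
  As the window of \<open>\<sigma>\<close> is increasing, the length order compares two digits by their places in
  \<open>\<sigma>\<close>. Hence \<open>\<pi>\<close> has as many inversions as the ordinary permutation \<open>|\<sigma>|\<^sup>-\<^sup>1|\<pi>|\<close>.
\<close>

lemma inversions_eq_perm_inv:
  assumes "r > 1" "\<pi> \<in> carrier (colored_perm_group r n)"
  shows "inversions n \<pi> = perm_inv n (inv' (snd (colored_part r n \<pi>)) \<circ> snd \<pi>)"
proof -
  define \<sigma> where "\<sigma> = colored_part r n \<pi>"
  let ?q = "inv' (snd \<sigma>) \<circ> snd \<pi>"
  have \<sigma>: "snd \<sigma> permutes {1..n}" and col: "fst \<sigma> = fst \<pi>"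
    and sorted: "\<And>i j. \<lbrakk>1 \<le> i; i < j; j \<le> n\<rbrakk> \<Longrightarrow> length_less (window \<sigma> i) (window \<sigma> j)"
    using colored_part_props[OF assms] unfolding \<sigma>_def by blast+
  have \<pi>: "snd \<pi> permutes {1..n}" using assms(2) by (cases \<pi>) (simp add: colored_perm_group_simps)
  have q: "?q permutes {1..n}" using \<pi> permutes_inv[OF \<sigma>] by (rule permutes_compose)
  \<comment> \<open>Place \<open>?q i\<close> of \<open>\<sigma>\<close> holds the digit in place
    \<open>i\<close> of \<open>\<pi>\<close>, and the two color vectors agree.\<close>
  have w: "window \<pi> i = window \<sigma> (?q i)" for i
    using permutes_inverses[OF \<sigma>] col by (simp add: window_def digit_color_def)
  have "length_less (window \<pi> j) (window \<pi> i) \<longleftrightarrow> ?q j < ?q i"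
    if "i \<in> {1..n}" "j \<in> {1..n}" "i < j" for i j
  proof -
    have "?q i \<in> {1..n}" "?q j \<in> {1..n}" using that permutes_in_image[OF q] by blast+
    moreover have "?q i \<noteq> ?q j" using that(3) permutes_inj[OF q] by (metis injD less_irrefl)
    ultimately show ?thesis
      using sorted[of "?q i" "?q j"] sorted[of "?q j" "?q i"] length_less_asym
      unfolding w by (metis atLeastAtMost_iff nat_neq_iff)
  qed
  then have "{(i, j). i \<in> {1..n} \<and> j \<in> {1..n} \<and> i < j \<and> length_less (window \<pi> j) (window \<pi> i)} =
      {(i, j). i \<in> {1..n} \<and> j \<in> {1..n} \<and> i < j \<and> ?q j < ?q i}"
    by blast
  then show ?thesis by (simp only: inversions_def perm_inv_def \<sigma>_def)
qed

text \<open>The invariant of the sort. Round \<open>k\<close> moves the value \<open>k\<close> of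
  \<open>q\<close> left to place \<open>k\<close> past larger values only, so each letter removes
  one inversion, and each letter also flips the character.\<close>

lemma sort_state_props:
  assumes "r > 1" "even r" "\<pi> \<in> carrier (colored_perm_group r n)" "k < n"
  defines "q \<equiv> \<lambda>k. inv' (snd (colored_part r n \<pi>)) \<circ> snd (sort_state r n \<pi> k)"
  shows "fst (sort_state r n \<pi> k) = fst \<pi> \<and> (\<forall>i\<in>{1..k}. q k i = i) \<and>
    perm_inv n (q k) + (\<Sum>j=1..k. length (sort_factor r n \<pi> j)) = perm_inv n (q 0) \<and>
    alt_character r n (sort_state r n \<pi> k) =
      alt_character r n \<pi> * (-1) ^ (\<Sum>j=1..k. length (sort_factor r n \<pi> j))"
  using assms(4)
proof (induction k)
  case 0
  then show ?case by simp
next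
  case (Suc k)
  let ?G = "colored_perm_group r n"
  define \<sigma> where "\<sigma> = colored_part r n \<pi>"
  define \<rho> where "\<rho> = sort_state r n \<pi> k"
  define p where "p = inv' (snd \<rho>) (snd \<sigma> (Suc k))"
  have \<rho>c: "\<rho> \<in> carrier ?G"
    unfolding \<rho>_def using assms Suc.prems by (intro sort_state_carrier) auto
  then have \<rho>: "snd \<rho> permutes {1..n}" by (cases \<rho>) (simp add: colored_perm_group_simps)
  have \<sigma>: "snd \<sigma> permutes {1..n}" using colored_part_props(2)[OF assms(1,3)] by (simp add: \<sigma>_def)
  have qk: "q k = inv' (snd \<sigma>) \<circ> snd \<rho>" by (simp add: q_def \<sigma>_def \<rho>_def)
  have qperm: "q k permutes {1..n}"
    unfolding qk using \<rho> permutes_inv[OF \<sigma>] by (rule permutes_compose)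
  have qp: "q k p = Suc k"
    by (simp add: qk p_def permutes_inverses[OF \<rho>] permutes_inverses[OF \<sigma>])
  have fixed: "q k i = i" if "i \<in> {1..k}" for i using Suc that by simp
  have p_in: "p \<in> {1..n}"
    using qp permutes_in_image[OF qperm, of p] Suc.prems by simp
  \<comment> \<open>The first \<open>k\<close> places carry the values \<open>1..k\<close>, so the
    value \<open>Suc k\<close> occurs further right.\<close>
  have "p \<notin> {1..k}" using fixed[of p] qp by auto
  then have p: "Suc k \<le> p" "p \<le> n" using p_in by auto
  have factor: "sort_factor r n \<pi> (Suc k) = rev [Suc k..<p]"
    by (simp add: sort_factor_def sort_word_def p_def \<sigma>_def \<rho>_def)
  let ?w = "word_value ?G s_gen (rev [Suc k..<p])"
  have next_eq: "sort_state r n \<pi> (Suc k) = \<rho> \<otimes>\<^bsub>?G\<^esub> ?w"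
    by (simp add: sort_word_def p_def \<sigma>_def \<rho>_def)
  have state: "sort_state r n \<pi> (Suc k) = (fst \<rho>, snd \<rho> \<circ> cyc (Suc k) p)"
    unfolding next_eq using mult_descending_word[OF \<rho>c assms(1) _ p] by simp
  have qS: "q (Suc k) = q k \<circ> cyc (Suc k) p"
    unfolding qk by (simp add: q_def state \<sigma>_def comp_assoc del: sort_state.simps)
  have "q (Suc k) i = i" if "i \<in> {1..Suc k}" for i
    using that fixed[of i] qp unfolding qS by (cases "i = Suc k") (auto simp: cyc_def)
  moreover have "perm_inv n (q (Suc k)) + (p - Suc k) = perm_inv n (q k)"
    unfolding qS
  proof (rule perm_inv_cyc)
    fix j assume j: "j \<in> {Suc k..<p}"
    \<comment> \<open>By injectivity the values \<open>1..k\<close> are used up on the first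
      \<open>k\<close> places and \<open>Suc k\<close> at \<open>p\<close>, so every value that is
      passed exceeds \<open>Suc k\<close>.\<close>
    have "q k j \<notin> {1..k}"
    proof
      assume "q k j \<in> {1..k}"
      then have "q k (q k j) = q k j" by (rule fixed)
      then have "q k j = j" using permutes_inj[OF qperm] by (metis injD)
      then show False using \<open>q k j \<in> {1..k}\<close> j by simp
    qed
    moreover have "q k j \<noteq> Suc k"
      using qp j permutes_inj[OF qperm] by (metis injD atLeastLessThan_iff less_irrefl)
    moreover have "q k j \<in> {1..n}" using j p permutes_in_image[OF qperm, of j] by simp
    ultimately show "q k p < q k j" by (auto simp: qp)
  qed (use p in auto)
  moreover have "alt_character r n (sort_state r n \<pi> (Suc k)) =
      alt_character r n \<rho> * (-1) ^ (p - Suc k)"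
  proof -
    have grp: "group ?G" using assms(1) by (intro colored_perm_group_is_group) simp
    have "?w \<in> carrier ?G"
      using assms(1) p by (intro word_value_carrier grp s_gen_carrier) auto
    moreover have "alt_character r n ?w = (-1) ^ length (rev [Suc k..<p])"
      using assms(1,2) p by (intro alt_character_word_value) auto
    ultimately show ?thesis
      using assms(1,2) \<rho>c by (simp add: alt_character_mult next_eq del: sort_state.simps)
  qed
  ultimately show ?case
    using Suc by (auto simp: factor state power_add \<rho>_def simp del: sort_state.simps)
qed

text \<open>The last place has only its own value left. This is why \<open>n - 1\<close> rounds of
  sorting suffice.\<close>

lemma permutes_eq_id_off_last:
  fixes n :: nat
  assumes "q permutes {1..n}" "\<And>i. i \<in> {1..n - 1} \<Longrightarrow> q i = i"
  shows "q = id"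
proof
  fix x
  show "q x = id x"
  proof (cases "x = n \<and> x \<in> {1..n}")
    case True
    have "q x \<notin> {1..n - 1}"
    proof
      assume *: "q x \<in> {1..n - 1}"
      then have "q (q x) = q x" by (rule assms(2))
      then have "q x = x" using permutes_inj[OF assms(1)] by (metis injD)
      then show False using True * by auto
    qed
    moreover have "q x \<in> {1..n}" using True permutes_in_image[OF assms(1)] by blast
    ultimately show ?thesis using True by auto
  next
    case False
    then show ?thesis using assms(2)[of x] permutes_not_in[OF assms(1), of x]
      by (cases "x \<in> {1..n - 1}") auto
  qed
qed

lemma length_ordering_part:
  "length (ordering_part r n \<pi>) = (\<Sum>j=1..n - 1. length (sort_factor r n \<pi> j))"
proof -
  have "length (ordering_part r n \<pi>) = sum_list (map (\<lambda>j. length (sort_factor r n \<pi> j)) [1..<n])"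
    by (simp add: ordering_part_def length_concat comp_def rev_map[symmetric])
  also have "\<dots> = (\<Sum>j\<in>{1..<n}. length (sort_factor r n \<pi> j))"
    by (simp add: sum_list_distinct_conv_sum_set)
  also have "{1..<n} = {1..n - 1}" by auto
  finally show ?thesis .
qed

text \<open>The sort ends at \<open>\<sigma>\<close>, where no inversion is left, so its letters
  account for all inversions of \<open>\<pi>\<close>. The second claim compares the characters at
  the two ends of the sort, that of \<open>\<sigma>\<close> being given by the coloring
  part.\<close>

lemma ordering_part_props:
  assumes "r > 1" "even r" "\<pi> \<in> carrier (colored_perm_group r n)" "n > 0"
  shows "length (ordering_part r n \<pi>) = inversions n \<pi>"
    and "alt_character r n \<pi> = (-1) ^ length (canonical_word r n \<pi>)"
proof -
  let ?\<sigma> = "colored_part r n \<pi>" and ?\<rho> = "sort_state r n \<pi> (n - 1)"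
  let ?q = "inv' (snd ?\<sigma>) \<circ> snd ?\<rho>"
  have k: "n - 1 < n" using assms(4) by simp
  note props = sort_state_props[OF assms(1-3) k]
  have \<rho>: "?\<rho> \<in> carrier (colored_perm_group r n)"
    using assms by (intro sort_state_carrier) auto
  then have "snd ?\<rho> permutes {1..n}" by (cases ?\<rho>) (simp add: colored_perm_group_simps)
  moreover note \<sigma> = colored_part_props(2)[OF assms(1,3)]
  ultimately have "?q permutes {1..n}" using permutes_inv[OF \<sigma>] by (intro permutes_compose)
  then have q: "?q = id"
    by (rule permutes_eq_id_off_last) (use props in blast)
  then show len: "length (ordering_part r n \<pi>) = inversions n \<pi>"
    using props perm_inv_id[of n ?q]
    by (simp add: length_ordering_part inversions_eq_perm_inv[OF assms(1,3)])
  have "snd ?\<rho> i = snd ?\<sigma> i" for i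
    using fun_cong[OF q, of i] permutes_inverses(1)[OF \<sigma>] by (metis comp_apply id_apply)
  then have "?\<rho> = ?\<sigma>"
    using props colored_part_props(1)[OF assms(1,3)] by (simp add: prod_eq_iff fun_eq_iff)
  moreover have "alt_character r n ?\<sigma> = (-1) ^ length (coloring_part n \<pi>)"
    unfolding colored_part_def using assms coloring_part_letters[of _ n \<pi>]
    by (intro alt_character_word_value) auto
  ultimately have *: "alt_character r n \<pi> * (-1) ^ length (ordering_part r n \<pi>) =
      (-1) ^ length (coloring_part n \<pi>)"
    using props by (simp add: length_ordering_part)
  \<comment> \<open>The sign of the ordering part squares to 1, which carries it to the other side
    of \<open>*\<close>.\<close>
  have "alt_character r n \<pi> =
      alt_character r n \<pi> * (-1) ^ length (ordering_part r n \<pi>) * (-1) ^ length (ordering_part r n \<pi>)"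
    by (simp add: mult.assoc power_add[symmetric])
  then show "alt_character r n \<pi> = (-1) ^ length (canonical_word r n \<pi>)"
    unfolding * by (simp add: canonical_word_def power_add)
qed

text \<open>Needed because \<open>translate_pairs\<close> runs into \<open>undefined\<close> on
  words of odd length.\<close>

lemma even_length_canonical_word:
  assumes "even r" "r > 0" "n > 0" "\<pi> \<in> alternating_subgroup r n"
  shows "even (length (canonical_word r n \<pi>))"
proof -
  have "r > 1" using assms(1,2) by presburger
  moreover have "\<pi> \<in> carrier (colored_perm_group r n)" "alt_character r n \<pi> = 1"
    using assms(4) by (auto simp: alternating_subgroup_def kernel_def sign_img_def)
  ultimately have "(-1 :: int) ^ length (canonical_word r n \<pi>) = 1"
    using ordering_part_props(2)[of r \<pi> n] assms by simp
  then show ?thesis by (simp add: minus_one_power_iff split: if_splits)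
qed


section \<open>Runs of the letter \<open>s\<^sub>0\<close>\<close>

definition blocks :: "(nat \<Rightarrow> nat) \<Rightarrow> (nat \<Rightarrow> nat list) \<Rightarrow> nat list \<Rightarrow> nat list" where
  "blocks z b ks = concat (map (\<lambda>i. replicate (z i) 0 @ b i) ks)"

lemma blocks_simps [simp]:
  "blocks z b [] = []"
  "blocks z b (i # ks) = replicate (z i) 0 @ b i @ blocks z b ks"
  by (simp_all add: blocks_def)

text \<open>
  The words \<open>b i\<close> separate the nonempty blocks of zeros, so that these are the maximal runs of
  zeros. The flag tells whether a block of zeros may come first.
\<close>

fun separated :: "(nat \<Rightarrow> nat) \<Rightarrow> (nat \<Rightarrow> nat list) \<Rightarrow> bool \<Rightarrow> nat list \<Rightarrow> bool" where
  "separated z b f [] = True"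
| "separated z b f (i # ks) =
     (if z i = 0 then separated z b (f \<or> b i \<noteq> []) ks else f \<and> separated z b (b i \<noteq> []) ks)"

lemma separated_mono: "separated z b f ks \<Longrightarrow> separated z b True ks"
  by (induction ks arbitrary: f) (auto split: if_splits)

lemma append_Cons_eq_first:
  assumes "x @ a # u = y @ a # v" "a \<notin> set x" "a \<notin> set y"
  shows "x = y \<and> u = v"
  using assms
proof (induction x arbitrary: y)
  case Nil
  then show ?case by (cases y) auto
next
  case (Cons c x)
  then show ?case by (cases y) auto
qed

text \<open>
  The decomposition of a word into blocks is not unique where \<open>z i = 0\<close>, but being separated
  depends on the word and on \<open>z\<close> only.
\<close>

lemma separated_transfer:
  assumes "x @ blocks z b ks = y @ blocks z c ks" "0 \<notin> set x" "0 \<notin> set y"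
    and "\<And>i. i \<in> set ks \<Longrightarrow> 0 \<notin> set (b i)" "\<And>i. i \<in> set ks \<Longrightarrow> 0 \<notin> set (c i)"
    and "separated z c (y \<noteq> []) ks"
  shows "separated z b (x \<noteq> []) ks"
  using assms
proof (induction ks arbitrary: x y)
  case Nil
  then show ?case by simp
next
  case (Cons i ks)
  show ?case
  proof (cases "z i")
    case 0
    \<comment> \<open>With no zeros in this block, \<open>b i\<close> and \<open>c i\<close> join
      the zero-free prefixes, which may thus differ between the two decompositions.\<close>
    have "separated z b (x @ b i \<noteq> []) ks"
      using Cons.prems 0 by (intro Cons.IH[of "x @ b i" "y @ c i"]) auto
    then show ?thesis using 0 by simp
  next
    case (Suc m)
    \<comment> \<open>Both prefixes end at the first zero of the common word, so they agree.\<close>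
    have "x = y \<and> replicate m 0 @ b i @ blocks z b ks = replicate m 0 @ c i @ blocks z c ks"
      by (rule append_Cons_eq_first[of x 0]) (use Cons.prems Suc in auto)
    then have eq: "x = y" "b i @ blocks z b ks = c i @ blocks z c ks" by auto
    have "separated z b (b i \<noteq> []) ks"
      using Cons.prems Suc by (intro Cons.IH[OF eq(2)]) auto
    then show ?thesis using Cons.prems Suc eq by simp
  qed
qed

text \<open>If the digit \<open>i + 1\<close> is colored, the block at \<open>i\<close> is
  \<open>s_i\<close> down to \<open>s_1\<close>, which is nonempty as \<open>i\<close> is at least
  1.\<close>

lemma separated_canonical_block:
  assumes "1 \<le> i" "i \<le> n" "digit_color \<pi> i \<noteq> 0 \<Longrightarrow> f"
  shows "separated (digit_color \<pi>) (canonical_block r n \<pi>) f [i..<n+1]"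
  using assms(2,1,3)
proof (induction i arbitrary: f rule: inc_induct)
  case base
  then show ?case by simp
next
  case (step i)
  let ?b = "canonical_block r n \<pi>"
  have b: "?b i \<noteq> []" if "digit_color \<pi> (Suc i) \<noteq> 0"
    using that step by (simp add: canonical_block_def)
  have "separated (digit_color \<pi>) ?b g [Suc i..<n+1]" if "?b i \<noteq> [] \<Longrightarrow> g" for g
    using that b by (intro step.IH) auto
  then have "separated (digit_color \<pi>) ?b f (i # [Suc i..<n+1])"
    using step.prems by (simp del: upt_Suc)
  moreover have "[i..<n+1] = i # [Suc i..<n+1]" using step by (intro upt_conv_Cons) simp
  ultimately show ?case by simp
qed


section \<open>The translation\<close>

text \<open>\<open>translate_from r e w\<close> translates \<open>w\<close> as a part of a longer word, at an even position iff \<open>e\<close>.\<close>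

fun translate_from :: "nat \<Rightarrow> bool \<Rightarrow> nat list \<Rightarrow> a_letter list" where
  "translate_from r e [] = []"
| "translate_from r e (i # w) =
     (if e then left_factor r i else right_factor r i) @ translate_from r (\<not> e) w"

lemma translate_pairs_eq:
  "even (length w) \<Longrightarrow> translate_pairs r w = translate_from r True w"
  by (induction r w rule: translate_pairs.induct) auto

lemma translate_from_append:
  "translate_from r e (u @ v) = translate_from r e u @ translate_from r (if even (length u) then e else \<not> e) v"
  by (induction u arbitrary: e) auto

text \<open>Left and right factor of \<open>s_0\<close> are the same power of \<open>a_0\<close>, so
  the parity \<open>e\<close> does not matter.\<close>

lemma translate_from_replicate_0:
  "translate_from r e (replicate m 0) = replicate (m * ((r + 2) div 4)) a0"
  by (induction m arbitrary: e) (auto simp: left_factor_def right_factor_def replicate_add)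

text \<open>Either factor of a letter other than \<open>s_0\<close> is a single letter with the same
  index; the position in the word affects only the sign at index 1.\<close>

lemma translate_from_letters:
  assumes "b \<in> lists {1..<n}"
  shows "translate_from r e b \<in> lists (a_letters n - {a0})"
    and "list_all2 (\<lambda>j (j', \<epsilon>). j' = j \<and> (if j = 1 then \<epsilon> \<in> {1, -1} else \<epsilon> = 1))
      b (translate_from r e b)"
  using assms by (induction b arbitrary: e) (auto simp: left_factor_def right_factor_def a_letters_def)

section \<open>Reducing the runs of \<open>a_0\<close>\<close>

lemma reduce_runs_append:
  "a0 \<notin> set u \<Longrightarrow> reduce_runs r (u @ v) = u @ reduce_runs r v"
  by (induction u) auto

text \<open>The assumption says that the run ends where \<open>v\<close> begins, so
  \<open>takeWhile\<close> counts exactly its letters.\<close>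

lemma reduce_runs_replicate:
  assumes "v = [] \<or> hd v \<noteq> a0"
  shows "reduce_runs r (replicate m a0 @ v) = replicate (m mod (r div 2)) a0 @ reduce_runs r v"
proof (cases m)
  case 0
  then show ?thesis by simp
next
  case (Suc k)
  have "takeWhile (\<lambda>y. y = a0) (replicate j a0 @ v) = replicate j a0" for j
    using assms by (induction j) (cases v, auto)
  moreover have "dropWhile (\<lambda>y. y = a0) (replicate j a0 @ v) = v" for j
    using assms by (induction j) (cases v, auto)
  ultimately show ?thesis using Suc by simp
qed

text \<open>For \<open>r = 4 * k + 2\<close> the factor is \<open>k + 1\<close>, and
  \<open>2 * (k + 1)\<close> is 1 modulo \<open>2 * k + 1\<close>. An odd \<open>a\<close> becomes
  even on adding the odd number \<open>r div 2\<close>.\<close>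

lemma mult_half_mod_eq_oslash2:
  assumes "r mod 4 = 2"
  shows "a * ((r + 2) div 4) mod (r div 2) = oslash2 r a"
proof -
  define k where "k = r div 4"
  have r: "r = 4 * k + 2" using assms by (simp add: k_def) presburger
  have h: "r div 2 = 2 * k + 1" and c: "(r + 2) div 4 = k + 1" using r by simp_all
  show ?thesis
  proof (cases "even a")
    case True
    then obtain m where m: "a = 2 * m" by blast
    have "a * (k + 1) = m + m * (2 * k + 1)" by (simp add: m algebra_simps)
    then have "a * (k + 1) mod (2 * k + 1) = m mod (2 * k + 1)" by (metis mod_mult_self1 mult.commute)
    then show ?thesis unfolding oslash2_def h c using True by (simp add: m)
  next
    case False
    then obtain m where m: "a = 2 * m + 1" by (metis oddE)
    have "a * (k + 1) = m + k + 1 + m * (2 * k + 1)" by (simp add: m algebra_simps)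
    then have "a * (k + 1) mod (2 * k + 1) = (m + k + 1) mod (2 * k + 1)"
      by (metis mod_mult_self1 mult.commute)
    moreover have "(a + (2 * k + 1)) div 2 = m + k + 1" by (simp add: m)
    ultimately show ?thesis unfolding oslash2_def h c using False by (simp add: add_ac)
  qed
qed

lemma separated_False_start:
  assumes "separated z b False ks" "\<And>i. i \<in> set ks \<Longrightarrow> 0 \<notin> set (b i)"
  shows "blocks z b ks = [] \<or> hd (blocks z b ks) \<noteq> 0"
  using assms
proof (induction ks)
  case (Cons i ks)
  then show ?case using Cons.prems(2)[of i] by (cases "b i") (auto split: if_splits)
qed simp

lemma hd_translate_from:
  assumes "w = [] \<or> hd w \<noteq> 0"
  shows "translate_from r e w = [] \<or> hd (translate_from r e w) \<noteq> a0"
  using assms by (cases w) (auto simp: left_factor_def right_factor_def)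

text \<open>Separation keeps the zeros of a block from running on into the next one, so each block
  is reduced by itself. The parity \<open>e\<close> varies in the induction, since a block may start
  at either parity.\<close>

lemma reduce_runs_blocks:
  assumes "r mod 4 = 2" "distinct ks" "separated z b True ks"
    and "\<And>i. i \<in> set ks \<Longrightarrow> b i \<in> lists {1..<n}"
  shows "\<exists>b'. reduce_runs r (translate_from r e (blocks z b ks)) =
      concat (map (\<lambda>i. replicate (oslash2 r (z i)) a0 @ b' i) ks) \<and>
    (\<forall>i\<in>set ks. \<exists>e. b' i = translate_from r e (b i))"
  using assms(2-4)
proof (induction ks arbitrary: e)
  case Nil
  then show ?case by simp
next
  case (Cons i ks)
  have nz: "0 \<notin> set (b j)" if "j \<in> set (i # ks)" for j
    using Cons.prems(3)[OF that] by auto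
  have sep: "separated z b True ks" using Cons.prems(2) separated_mono by (auto split: if_splits)
  \<comment> \<open>The parities of the positions where \<open>b i\<close> and the remaining blocks
    start.\<close>
  define e1 where "e1 = (if even (z i) then e else \<not> e)"
  define e2 where "e2 = (if even (length (b i)) then e1 else \<not> e1)"
  obtain b' where b': "reduce_runs r (translate_from r e2 (blocks z b ks)) =
      concat (map (\<lambda>i. replicate (oslash2 r (z i)) a0 @ b' i) ks)"
    "\<forall>i\<in>set ks. \<exists>e. b' i = translate_from r e (b i)"
    using Cons.IH[OF _ sep, of e2] Cons.prems by auto
  let ?B = "translate_from r e1 (b i)" and ?W = "translate_from r e2 (blocks z b ks)"
  have BW: "?B @ ?W = translate_from r e1 (b i @ blocks z b ks)"
    by (simp add: translate_from_append e2_def)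
  have tr: "translate_from r e (blocks z b (i # ks)) =
      replicate (z i * ((r + 2) div 4)) a0 @ ?B @ ?W"
    by (simp add: translate_from_append translate_from_replicate_0 e1_def e2_def)
  have a0: "a0 \<notin> set ?B"
    using translate_from_letters(1)[of "b i" n r e1] Cons.prems(3)[of i] by auto
  have "reduce_runs r (replicate (z i * ((r + 2) div 4)) a0 @ ?B @ ?W) =
      replicate (oslash2 r (z i)) a0 @ reduce_runs r (?B @ ?W)"
  proof (cases "z i = 0")
    case True
    then show ?thesis by (simp add: oslash2_def)
  next
    case False
    then have "separated z b (b i \<noteq> []) ks" using Cons.prems(2) by simp
    then have "b i @ blocks z b ks = [] \<or> hd (b i @ blocks z b ks) \<noteq> 0"
      using nz nz[of i] separated_False_start[of z b ks] by (cases "b i") auto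
    then have "?B @ ?W = [] \<or> hd (?B @ ?W) \<noteq> a0"
      unfolding BW by (rule hd_translate_from)
    from reduce_runs_replicate[OF this] show ?thesis
      by (simp only: mult_half_mod_eq_oslash2[OF assms(1)])
  qed
  then have red: "reduce_runs r (translate_from r e (blocks z b (i # ks))) =
      replicate (oslash2 r (z i)) a0 @ ?B @ reduce_runs r ?W"
    unfolding tr using a0 by (simp add: reduce_runs_append)
  \<comment> \<open>As \<open>ks\<close> is distinct, the new value at \<open>i\<close> leaves the
    later blocks unchanged.\<close>
  have upd: "map (\<lambda>j. replicate (oslash2 r (z j)) a0 @ (b'(i := ?B)) j) ks =
      map (\<lambda>j. replicate (oslash2 r (z j)) a0 @ b' j) ks"
    using Cons.prems(1) by (intro map_cong) auto
  have "reduce_runs r (translate_from r e (blocks z b (i # ks))) =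
      concat (map (\<lambda>j. replicate (oslash2 r (z j)) a0 @ (b'(i := ?B)) j) (i # ks))"
    unfolding red b'(1) list.map(2) upd by simp
  moreover have "\<forall>j\<in>set (i # ks). \<exists>e. (b'(i := ?B)) j = translate_from r e (b j)"
    using b'(2) by auto
  ultimately show ?case by blast
qed

text \<open>The given \<open>b\<close> may differ from \<open>canonical_block\<close>. The latter is
  known to be separated, and this carries over to \<open>b\<close> because both spell the same
  word.\<close>

lemma translation_canonical_word:
  assumes "r mod 4 = 2" "n > 0" "\<pi> \<in> alternating_subgroup r n"
    and b: "\<And>i. i \<in> {1..n} \<Longrightarrow> b i \<in> lists {1..<n}"
    and word: "canonical_word r n \<pi> =
      concat (map (\<lambda>i. replicate (digit_color \<pi> i) 0 @ b i) [1..<n+1])"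
  shows "\<exists>b' :: nat \<Rightarrow> a_letter list.
    translation r (canonical_word r n \<pi>) =
      concat (map (\<lambda>i. replicate (oslash2 r (digit_color \<pi> i)) a0 @ b' i) [1..<n+1]) \<and>
    (\<forall>i\<in>{1..n}. b' i \<in> lists (a_letters n - {a0}) \<and>
      list_all2 (\<lambda>j (j', \<epsilon>). j' = j \<and> (if j = 1 then \<epsilon> \<in> {1, -1} else \<epsilon> = 1)) (b i) (b' i))"
proof -
  let ?z = "digit_color \<pi>" and ?c = "canonical_block r n \<pi>"
  have r: "r > 1" "even r" using assms(1) by presburger+
  have \<pi>: "\<pi> \<in> carrier (colored_perm_group r n)"
    using assms(3) by (simp add: alternating_subgroup_def kernel_def)
  have set_upt: "set [1..<n+1] = {1..n}" by auto
  have c: "?c i \<in> lists {1..<n}" if "i \<in> {1..n}" for i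
    using canonical_block_letters[OF r(1) \<pi> that] .
  have w: "canonical_word r n \<pi> = blocks ?z b [1..<n+1]" using word by (simp only: blocks_def)
  have "canonical_word r n \<pi> = blocks ?z ?c [1..<n+1]"
    using canonical_word_blocks[OF assms(2)] by (simp only: blocks_def)
  \<comment> \<open>The dummy letter 1 makes the prefix nonempty, which sets the flag of
    \<open>separated_transfer\<close> to \<open>True\<close>: the word may begin with zeros.\<close>
  then have eq: "[1] @ blocks ?z b [1..<n+1] = [1] @ blocks ?z ?c [1..<n+1]" using w by (simp only:)
  have nz: "0 \<notin> set u" if "u \<in> lists {1..<n}" for u using that by auto
  have b_in: "b i \<in> lists {1..<n}" if "i \<in> set [1..<n+1]" for i
    by (rule b) (use that in \<open>simp only: set_upt\<close>)
  have c_in: "?c i \<in> lists {1..<n}" if "i \<in> set [1..<n+1]" for i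
    by (rule c) (use that in \<open>simp only: set_upt\<close>)
  have "separated ?z ?c True [1..<n+1]"
    using assms(2) by (intro separated_canonical_block) auto
  then have "separated ?z ?c ([1::nat] \<noteq> []) [1..<n+1]" by (simp only: list.distinct simp_thms)
  then have "separated ?z b ([1::nat] \<noteq> []) [1..<n+1]"
    by (rule separated_transfer[OF eq _ _ nz[OF b_in] nz[OF c_in], rotated -1]) simp_all
  then have sep: "separated ?z b True [1..<n+1]" by (simp only: list.distinct simp_thms)
  have "\<exists>b'. reduce_runs r (translate_from r True (blocks ?z b [1..<n+1])) =
      concat (map (\<lambda>i. replicate (oslash2 r (?z i)) a0 @ b' i) [1..<n+1]) \<and>
    (\<forall>i\<in>set [1..<n+1]. \<exists>e. b' i = translate_from r e (b i))"
    by (rule reduce_runs_blocks[OF assms(1) distinct_upt sep b_in])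
  then obtain b' where b': "reduce_runs r (translate_from r True (blocks ?z b [1..<n+1])) =
      concat (map (\<lambda>i. replicate (oslash2 r (?z i)) a0 @ b' i) [1..<n+1])"
    "\<forall>i\<in>set [1..<n+1]. \<exists>e. b' i = translate_from r e (b i)"
    by (elim exE conjE)
  have "even (length (canonical_word r n \<pi>))"
    using r assms(2,3) by (intro even_length_canonical_word) auto
  then have "translation r (canonical_word r n \<pi>) =
      concat (map (\<lambda>i. replicate (oslash2 r (?z i)) a0 @ b' i) [1..<n+1])"
    using b'(1) by (simp only: translation_def translate_pairs_eq w)
  moreover have "b' i \<in> lists (a_letters n - {a0}) \<and>
      list_all2 (\<lambda>j (j', \<epsilon>). j' = j \<and> (if j = 1 then \<epsilon> \<in> {1, -1} else \<epsilon> = 1)) (b i) (b' i)"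
    if "i \<in> {1..n}" for i
  proof -
    have "i \<in> set [1..<n+1]" using that by (simp only: set_upt)
    then obtain e where "b' i = translate_from r e (b i)" using b'(2) by (elim bspec[elim_format] exE)
    then show ?thesis using translate_from_letters[OF b[OF that]] by (simp only: simp_thms)
  qed
  ultimately show ?thesis by blast
qed

text \<open>Translation preserves the lengths of the canonical blocks. The last block contributes
  the inversions and the others the sum of the \<open>i - 1\<close>.\<close>

lemma L_A_eq:
  assumes "r mod 4 = 2" "n > 0" "\<pi> \<in> alternating_subgroup r n"
  shows "L_A r n \<pi> = (\<Sum>i | i \<in> {1..n} \<and> digit_color \<pi> i \<noteq> 0. i - 1) + inversions n \<pi> +
    (\<Sum>i=1..n. oslash2 r (digit_color \<pi> i))"
proof -
  let ?z = "digit_color \<pi>" and ?c = "canonical_block r n \<pi>"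
  have r: "r > 1" "even r" using assms(1) by presburger+
  have \<pi>: "\<pi> \<in> carrier (colored_perm_group r n)"
    using assms(3) by (simp add: alternating_subgroup_def kernel_def)
  let ?P = "\<lambda>j (j', \<epsilon>). j' = j \<and> (if j = 1 then \<epsilon> \<in> {1, -1} else \<epsilon> = (1::int))"
  have "\<exists>b'. translation r (canonical_word r n \<pi>) =
      concat (map (\<lambda>i. replicate (oslash2 r (?z i)) a0 @ b' i) [1..<n+1]) \<and>
    (\<forall>i\<in>{1..n}. b' i \<in> lists (a_letters n - {a0}) \<and> list_all2 ?P (?c i) (b' i))"
    by (rule translation_canonical_word[OF assms canonical_block_letters[OF r(1) \<pi>]
          canonical_word_blocks[OF assms(2)]])
  then obtain b' where b': "translation r (canonical_word r n \<pi>) =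
      concat (map (\<lambda>i. replicate (oslash2 r (?z i)) a0 @ b' i) [1..<n+1])"
    and rel: "\<forall>i\<in>{1..n}. b' i \<in> lists (a_letters n - {a0}) \<and> list_all2 ?P (?c i) (b' i)"
    by (elim exE conjE)
  have len: "length (b' i) = length (?c i)" if "i \<in> {1..n}" for i
    using bspec[OF rel that] by (blast dest: list_all2_lengthD[symmetric])
  have "L_A r n \<pi> = sum_list (map (\<lambda>i. oslash2 r (?z i) + length (b' i)) [1..<n+1])"
    unfolding L_A_def b' length_concat map_map comp_def length_append length_replicate ..
  also have "\<dots> = (\<Sum>i\<in>{1..<n+1}. oslash2 r (?z i) + length (b' i))"
    by (simp only: sum_list_distinct_conv_sum_set distinct_upt set_upt)
  also have "{1..<n+1} = {1..n}" by auto
  also have "(\<Sum>i=1..n. oslash2 r (?z i) + length (b' i)) =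
      (\<Sum>i=1..n. oslash2 r (?z i)) + (\<Sum>i=1..n. length (?c i))"
    using len by (simp add: sum.distrib)
  also have "(\<Sum>i=1..n. length (?c i)) =
      (\<Sum>i | i \<in> {1..n} \<and> ?z i \<noteq> 0. i - 1) + inversions n \<pi>"
  proof -
    obtain m where n: "n = Suc m" using assms(2) by (cases n) auto
    have "(\<Sum>i=1..n. length (?c i)) = (\<Sum>i=1..m. length (?c i)) + inversions n \<pi>"
      using ordering_part_props(1)[OF r \<pi> assms(2)] by (simp add: n canonical_block_def)
    \<comment> \<open>The block at \<open>i\<close> belongs to the digit \<open>Suc i\<close> and
      has length \<open>i\<close>.\<close>
    also have "(\<Sum>i=1..m. length (?c i)) = (\<Sum>i=1..m. if ?z (Suc i) \<noteq> 0 then i else 0)"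
      by (rule sum.cong) (auto simp: n canonical_block_def)
    \<comment> \<open>The added term at 0, for the digit 1, is zero; it prepares the index
      shift.\<close>
    also have "\<dots> = (\<Sum>i=0..m. if ?z (Suc i) \<noteq> 0 then Suc i - 1 else 0)"
      by (simp add: sum.atLeast_Suc_atMost cong: if_cong)
    also have "\<dots> = (\<Sum>i=1..n. if ?z i \<noteq> 0 then i - 1 else 0)"
      using sum.shift_bounds_cl_Suc_ivl[of "\<lambda>i. if ?z i \<noteq> 0 then i - 1 else 0" 0 m] by (simp add: n)
    also have "\<dots> = (\<Sum>i | i \<in> {1..n} \<and> ?z i \<noteq> 0. i - 1)"
      by (subst sum.inter_filter[symmetric]) simp_all
    finally show ?thesis .
  qed
  finally show ?thesis by simp
qed

theorem theorem4p8:
  fixes r n :: nat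
  assumes "r > 0" and "n > 0" and "r mod 4 = 2"
  shows "(\<forall>\<pi> \<in> alternating_subgroup r n. \<forall>b :: nat \<Rightarrow> nat list.
           (\<forall>i\<in>{1..n}. b i \<in> lists {1..<n}) \<longrightarrow>
           canonical_word r n \<pi> =
             concat (map (\<lambda>i. replicate (digit_color \<pi> i) 0 @ b i) [1..<n+1]) \<longrightarrow>
           (\<exists>b' :: nat \<Rightarrow> a_letter list.
              translation r (canonical_word r n \<pi>) =
                concat (map (\<lambda>i. replicate (oslash2 r (digit_color \<pi> i)) a0 @ b' i) [1..<n+1]) \<and>
              (\<forall>i\<in>{1..n}. b' i \<in> lists (a_letters n - {a0}) \<and>
                 list_all2 (\<lambda>j (j', \<epsilon>). j' = j \<and> (if j = 1 then \<epsilon> \<in> {1, -1} else \<epsilon> = 1))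
                   (b i) (b' i)))) \<and>
         (\<forall>\<pi> \<in> alternating_subgroup r n.
           L_A r n \<pi> =
             (\<Sum>i | i \<in> {1..n} \<and> digit_color \<pi> i \<noteq> 0. i - 1) + inversions n \<pi> +
             (\<Sum>i=1..n. oslash2 r (digit_color \<pi> i)))"
proof (intro conjI ballI allI impI)
  fix \<pi> and b :: "nat \<Rightarrow> nat list"
  assume \<pi>: "\<pi> \<in> alternating_subgroup r n" and b: "\<forall>i\<in>{1..n}. b i \<in> lists {1..<n}"
    and word: "canonical_word r n \<pi> = concat (map (\<lambda>i. replicate (digit_color \<pi> i) 0 @ b i) [1..<n+1])"
  show "\<exists>b' :: nat \<Rightarrow> a_letter list.
      translation r (canonical_word r n \<pi>) =
        concat (map (\<lambda>i. replicate (oslash2 r (digit_color \<pi> i)) a0 @ b' i) [1..<n+1]) \<and>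
      (\<forall>i\<in>{1..n}. b' i \<in> lists (a_letters n - {a0}) \<and>
        list_all2 (\<lambda>j (j', \<epsilon>). j' = j \<and> (if j = 1 then \<epsilon> \<in> {1, -1} else \<epsilon> = 1)) (b i) (b' i))"
    by (rule translation_canonical_word[OF assms(3,2) \<pi> bspec[OF b] word])
qed (rule L_A_eq[OF assms(3,2)])

end
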